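(* Let $\mathcal{H}$ be a complex Hilbert space, let $T \in \mathcal{B}(\mathcal{H})$ and let $\lambda \geq 0$ be a real number. Then $$w^4(T) \leq \frac{2\lambda +3}{8(\lambda + 1)} \left\||T|^2 + |T^*|^2\right\|\,w(T^2) + \frac{2\lambda +1}{8(\lambda +1)}\left\||T|^4 + |T^*|^4\right\|.$$
   Context: $\mathcal{B}(\mathcal{H})$ is the $C^*$-algebra of all bounded linear operators on $\mathcal{H}$; $\|\cdot\|$ is the operator norm. For $T\in\mathcal{B}(\mathcal{H})$, $|T| = (T^*T)^{1/2}$, and hence $|T^*| = (TT^* )^{1/2}$. The numerical radius is $w(T) = \sup_{\|x\|=1} |\langle Tx, x\rangle|$, and $w^p(T)$ denotes $(w(T))^p$. *)

theory Defs
  imports "HOL-Analysis.Analysis"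
begin

class complex_vector = real_vector +
  fixes scaleC :: "complex \<Rightarrow> 'a \<Rightarrow> 'a"  (infixr "*\<^sub>C" 75)
  assumes scaleC_add_right: "c *\<^sub>C (x + y) = c *\<^sub>C x + c *\<^sub>C y"
    and scaleC_add_left: "(c + d) *\<^sub>C x = c *\<^sub>C x + d *\<^sub>C x"
    and scaleC_scaleC: "c *\<^sub>C (d *\<^sub>C x) = (c * d) *\<^sub>C x"
    and scaleR_scaleC: "r *\<^sub>R x = complex_of_real r *\<^sub>C x"

text \<open>The inner product is linear in the first argument.\<close>

class complex_inner = complex_vector + real_normed_vector +
  fixes cinner :: "'a \<Rightarrow> 'a \<Rightarrow> complex"
  assumes cinner_commute: "cinner x y = cnj (cinner y x)"
    and cinner_add_left: "cinner (x + y) z = cinner x z + cinner y z"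
    and cinner_scaleC_left: "cinner (c *\<^sub>C x) y = c * cinner x y"
    and cinner_ge_zero: "0 \<le> Re (cinner x x)"
    and cinner_eq_zero_iff: "cinner x x = 0 \<longleftrightarrow> x = 0"
    and norm_eq_sqrt_cinner: "norm x = sqrt (Re (cinner x x))"

class chilbert_space = complex_inner + banach

text \<open>The type of bounded linear functions consists of the bounded \<^emph>\<open>real\<close>-linear maps, with the
  operator norm. The bounded operators on a complex Hilbert space are the complex-linear ones
  among them.\<close>

definition clinear_op :: "('a::complex_inner \<Rightarrow>\<^sub>L 'a) \<Rightarrow> bool" where
  "clinear_op T \<longleftrightarrow> (\<forall>c x. blinfun_apply T (c *\<^sub>C x) = c *\<^sub>C blinfun_apply T x)"

primrec op_power :: "('a::real_normed_vector \<Rightarrow>\<^sub>L 'a) \<Rightarrow> nat \<Rightarrow> ('a \<Rightarrow>\<^sub>L 'a)" where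
  "op_power T 0 = id_blinfun"
| "op_power T (Suc n) = T o\<^sub>L op_power T n"

definition adjoint_op :: "('a::chilbert_space \<Rightarrow>\<^sub>L 'a) \<Rightarrow> ('a \<Rightarrow>\<^sub>L 'a)" where
  "adjoint_op T =
    (THE S. \<forall>x y. cinner (blinfun_apply T x) y = cinner x (blinfun_apply S y))"

definition positive_op :: "('a::complex_inner \<Rightarrow>\<^sub>L 'a) \<Rightarrow> bool" where
  "positive_op A \<longleftrightarrow> clinear_op A \<and> (\<forall>x. cinner (blinfun_apply A x) x \<in> \<real>\<^sub>\<ge>\<^sub>0)"

text \<open>On a Hilbert space, a positive operator has exactly one positive square root, so the choice
  below is no choice.\<close>

definition sqrt_op :: "('a::chilbert_space \<Rightarrow>\<^sub>L 'a) \<Rightarrow> ('a \<Rightarrow>\<^sub>L 'a)" where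
  "sqrt_op A = (SOME S. positive_op S \<and> S o\<^sub>L S = A)"

definition abs_op :: "('a::chilbert_space \<Rightarrow>\<^sub>L 'a) \<Rightarrow> ('a \<Rightarrow>\<^sub>L 'a)" where
  "abs_op T = sqrt_op (adjoint_op T o\<^sub>L T)"

text \<open>Inserting \<open>0\<close> matters only for the zero space, which has no unit vectors: there the
  supremum, taken in the nonnegative reals, is \<open>0\<close>.\<close>

definition numerical_radius :: "('a::complex_inner \<Rightarrow>\<^sub>L 'a) \<Rightarrow> real" where
  "numerical_radius T = Sup (insert 0 {cmod (cinner (blinfun_apply T x) x) | x. norm x = 1})"

end

theory Submission
  imports Defs
begin

text \<open>For a unit vector \<open>x\<close>, choose \<open>c\<close> with \<open>cmod c = 1\<close> such that \<open>c * \<langle>T x, x\<rangle>\<close> is real and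
  nonnegative, and let \<open>R\<close> be the real part of \<open>c T\<close>. Then
  \<open>\<bar>\<langle>T x, x\<rangle>\<bar>\<^sup>2 = \<langle>R x, x\<rangle>\<^sup>2 \<le> \<parallel>R x\<parallel>\<^sup>2\<close>, and expanding the square gives
  \<open>w(T)\<^sup>2 \<le> \<parallel>|T|\<^sup>2 + |T\<^sup>*|\<^sup>2\<parallel> / 4 + w(T\<^sup>2) / 2\<close>. Squaring this, the claim follows from
  \<open>\<parallel>|T|\<^sup>2 + |T\<^sup>*|\<^sup>2\<parallel>\<^sup>2 \<le> 2 \<parallel>|T|\<^sup>4 + |T\<^sup>*|\<^sup>4\<parallel>\<close> and \<open>2 w(T\<^sup>2) \<le> \<parallel>|T|\<^sup>2 + |T\<^sup>*|\<^sup>2\<parallel>\<close>: the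
  case \<open>\<lambda> = 0\<close> is the strongest, since the two coefficients add up to \<open>1/2\<close> and these
  inequalities give \<open>\<parallel>|T|\<^sup>2 + |T\<^sup>*|\<^sup>2\<parallel> w(T\<^sup>2) \<le> \<parallel>|T|\<^sup>4 + |T\<^sup>*|\<^sup>4\<parallel>\<close>.\<close>

section \<open>Complex inner product spaces\<close>

lemma cinner_add_right: "cinner x (y + z) = cinner x y + cinner x z"
  by (metis cinner_add_left cinner_commute complex_cnj_add)

lemma cinner_scaleC_right: "cinner x (c *\<^sub>C y) = cnj c * cinner x y"
  by (metis cinner_commute cinner_scaleC_left complex_cnj_mult)

lemma cinner_scaleR_left: "cinner (r *\<^sub>R x) y = complex_of_real r * cinner x y"
  by (simp add: scaleR_scaleC cinner_scaleC_left)

lemma cinner_scaleR_right: "cinner x (r *\<^sub>R y) = complex_of_real r * cinner x y"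
  by (simp add: scaleR_scaleC cinner_scaleC_right)

lemma cinner_minus_left: "cinner (- x) y = - cinner x y"
  using cinner_scaleR_left[of "-1" x y] by simp

lemma cinner_minus_right: "cinner x (- y) = - cinner x y"
  using cinner_scaleR_right[of x "-1" y] by simp

lemma cinner_diff_left: "cinner (x - y) z = cinner x z - cinner y z"
  using cinner_add_left[of x "- y" z] by (simp add: cinner_minus_left)

lemma cinner_diff_right: "cinner x (y - z) = cinner x y - cinner x z"
  using cinner_add_right[of x y "- z"] by (simp add: cinner_minus_right)

lemma Re_cinner_commute: "Re (cinner x y) = Re (cinner y x)"
  by (metis cinner_commute cnj.sel(1))

lemma power2_norm_eq_Re_cinner: "(norm x)\<^sup>2 = Re (cinner x x)"
  by (simp add: norm_eq_sqrt_cinner cinner_ge_zero)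

lemma cinner_self: "cinner x x = complex_of_real ((norm x)\<^sup>2)"
proof -
  have "Im (cinner x x) = 0"
    using arg_cong[OF cinner_commute[of x x], of Im] by simp
  then show ?thesis
    by (simp add: complex_eq_iff power2_norm_eq_Re_cinner)
qed

lemma power2_norm_add:
  "(norm (x + y))\<^sup>2 = (norm x)\<^sup>2 + (norm y)\<^sup>2 + 2 * Re (cinner x y)"
  using Re_cinner_commute[of y x]
  by (simp add: power2_norm_eq_Re_cinner cinner_add_left cinner_add_right)

lemma power2_norm_diff:
  "(norm (x - y))\<^sup>2 = (norm x)\<^sup>2 + (norm y)\<^sup>2 - 2 * Re (cinner x y)"
  using Re_cinner_commute[of y x]
  by (simp add: power2_norm_eq_Re_cinner cinner_diff_left cinner_diff_right)

lemma norm_scaleC: "norm (c *\<^sub>C (x::'a::complex_inner)) = cmod c * norm x"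
proof -
  have "(norm (c *\<^sub>C x))\<^sup>2 = (cmod c * norm x)\<^sup>2"
  proof -
    have "cinner (c *\<^sub>C x) (c *\<^sub>C x) = (c * cnj c) * complex_of_real ((norm x)\<^sup>2)"
      by (simp only: cinner_scaleC_left cinner_scaleC_right mult.assoc) (simp add: cinner_self)
    then show ?thesis
      unfolding power2_norm_eq_Re_cinner[of "c *\<^sub>C x"] complex_norm_square[symmetric]
      by (simp add: power_mult_distrib flip: of_real_power of_real_mult)
  qed
  then show ?thesis
    by (simp add: power2_eq_iff_nonneg)
qed

text \<open>Cauchy-Schwarz for the real part: expanding the square of
  \<open>norm y *\<^sub>R x - norm x *\<^sub>R y\<close> produces the factor
  \<open>2 * (norm x * norm y)\<close>, which can be cancelled when both vectors are
  nonzero.\<close>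

lemma Re_cinner_le_norm: "Re (cinner x y) \<le> norm x * norm y"
proof (cases "x = 0 \<or> y = 0")
  case True
  then show ?thesis
    using cinner_scaleR_left[of 0 x y] cinner_scaleR_right[of x 0 y] by auto
next
  case False
  then have pos: "norm x > 0" "norm y > 0"
    by auto
  have "0 \<le> (norm (norm y *\<^sub>R x - norm x *\<^sub>R y))\<^sup>2"
    by simp
  also have "\<dots> = 2 * (norm x * norm y) * (norm x * norm y - Re (cinner x y))"
    unfolding power2_norm_diff
    by (simp add: cinner_scaleR_left cinner_scaleR_right algebra_simps power2_eq_square)
  finally have "0 \<le> 2 * (norm x * norm y) * (norm x * norm y - Re (cinner x y))" .
  then show ?thesis
    using mult_pos_pos[OF pos] by (simp add: zero_le_mult_iff)
qed

text \<open>Rotating by a phase turns bounds on real parts into bounds on moduli.\<close>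

lemma unit_phase: "\<exists>c. cmod c = 1 \<and> c * z = complex_of_real (cmod z)"
proof (cases "z = 0")
  case False
  then have "cmod (cnj z / cmod z) = 1" "cnj z / cmod z * z = complex_of_real (cmod z)"
    by (simp_all add: norm_divide divide_simps mult.commute[of "cnj z"] complex_norm_square[symmetric]
        power2_eq_square)
  then show ?thesis
    by blast
qed (auto intro: exI[of _ 1])

lemma norm_cinner_le: "cmod (cinner x y) \<le> norm x * norm y"
proof -
  obtain c where c: "cmod c = 1" "c * cinner x y = complex_of_real (cmod (cinner x y))"
    using unit_phase by blast
  then have "cmod (cinner x y) = Re (cinner (c *\<^sub>C x) y)"
    by (simp add: cinner_scaleC_left)
  also have "\<dots> \<le> norm x * norm y"
    using Re_cinner_le_norm[of "c *\<^sub>C x" y] c by (simp add: norm_scaleC)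
  finally show ?thesis .
qed

lemma bounded_bilinear_cinner: "bounded_bilinear cinner"
proof
  show "\<exists>K. \<forall>x y. cmod (cinner x y) \<le> norm x * norm y * K"
    by (rule exI[of _ 1]) (simp add: norm_cinner_le)
qed (simp_all add: cinner_add_left cinner_add_right cinner_scaleR_left cinner_scaleR_right
    scaleR_conv_of_real)

lemma bounded_linear_scaleC: "bounded_linear (\<lambda>x::'a::complex_inner. c *\<^sub>C x)"
proof
  show "\<exists>K. \<forall>x::'a. norm (c *\<^sub>C x) \<le> norm x * K"
    by (rule exI[of _ "cmod c"]) (simp add: norm_scaleC)
qed (simp_all add: scaleC_add_right scaleR_scaleC scaleC_scaleC mult.commute)

lemma scaleC_diff_right: "c *\<^sub>C (x - y) = c *\<^sub>C x - c *\<^sub>C (y::'a::complex_inner)"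
  by (rule linear_diff[OF bounded_linear.linear[OF bounded_linear_scaleC]])

text \<open>Real parts suffice, because the test vector \<open>y - z\<close> already yields the
  squared norm of the difference.\<close>

lemma cinner_ext:
  assumes "\<And>x. Re (cinner x y) = Re (cinner x z)"
  shows "y = z"
proof -
  have "(norm (y - z))\<^sup>2 = 0"
    using assms[of "y - z"] by (simp add: power2_norm_eq_Re_cinner cinner_diff_right)
  then show ?thesis
    by simp
qed

text \<open>The multipliers \<open>1\<close> and \<open>\<i>\<close> extract the real and imaginary
  parts. This lifts identities of real functionals to complex ones.\<close>

lemma cinner_eqI_Re:
  assumes "\<And>c. Re (c * a) = Re (c * b)"
  shows "a = b"
  using assms[of 1] assms[of \<i>] by (simp add: complex_eq_iff)

section \<open>The adjoint\<close>

text \<open>The representing vector minimizes \<open>\<parallel>x\<parallel>\<^sup>2 - 2 f x\<close>; minimizing sequences are Cauchy by the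
  parallelogram law.\<close>

lemma riesz_representation:
  fixes f :: "'a::chilbert_space \<Rightarrow> real"
  assumes "bounded_linear f"
  shows "\<exists>z. \<forall>x. f x = Re (cinner x z)"
proof -
  interpret f: bounded_linear f by fact
  define J where "J x = (norm x)\<^sup>2 - 2 * f x" for x
  obtain K where K: "\<And>x. norm (f x) \<le> norm x * K"
    using f.bounded by blast
  \<comment> \<open>Completing the square: \<open>f x \<le> norm x * K\<close> gives
    \<open>J x \<ge> (norm x - K)\<^sup>2 - K\<^sup>2\<close>.\<close>
  have lower: "J x \<ge> - K\<^sup>2" for x
  proof -
    have "0 \<le> (norm x - K)\<^sup>2"
      by simp
    then show ?thesis
      using K[of x] by (simp add: J_def power2_eq_square algebra_simps abs_le_iff)
  qed
  define d where "d = Inf (range J)"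
  have bdd: "bdd_below (range J)"
    by (rule bdd_belowI[of _ "- K\<^sup>2"]) (use lower in auto)
  have d_le: "d \<le> J x" for x
    unfolding d_def using bdd by (intro cInf_lower) auto
  have "\<exists>x. J x < d + 1 / real (Suc n)" for n
  proof -
    have "Inf (range J) < d + 1 / real (Suc n)"
      by (simp add: d_def)
    then show ?thesis
      using cInf_lessD[of "range J"] by blast
  qed
  then obtain u where u: "\<And>n. J (u n) < d + 1 / real (Suc n)"
    by metis
  \<comment> \<open>The parallelogram law, in which the contributions of \<open>f\<close> cancel. As
    the midpoint has value at least \<open>d\<close>, two near-minimizers must be close to each
    other.\<close>
  have par: "(norm (x - y))\<^sup>2 = 2 * J x + 2 * J y - 4 * J ((1/2) *\<^sub>R (x + y))" for x y
  proof -
    have "(norm ((1/2) *\<^sub>R (x + y)))\<^sup>2 = (norm (x + y))\<^sup>2 / 4"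
      unfolding norm_scaleR power_mult_distrib by (simp add: power2_eq_square)
    then show ?thesis
      using power2_norm_add[of x y] power2_norm_diff[of x y]
      unfolding J_def by (simp add: f.add f.scaleR field_simps del: scaleR_add_right)
  qed
  have dist_u: "(norm (u m - u n))\<^sup>2 < 2 / real (Suc m) + 2 / real (Suc n)" for m n
    using par[of "u m" "u n"] u[of m] u[of n] d_le[of "(1/2) *\<^sub>R (u m + u n)"] by simp
  have "Cauchy u"
  proof (rule CauchyI)
    fix e :: real
    assume e: "e > 0"
    obtain N where N: "4 / e\<^sup>2 < real N"
      using reals_Archimedean2 by blast
    have "norm (u m - u n) < e" if "m \<ge> N" "n \<ge> N" for m n
    proof -
      have "2 / real (Suc k) < e\<^sup>2 / 2" if "k \<ge> N" for k
      proof -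
        have "4 / e\<^sup>2 < real (Suc k)"
          using N that by linarith
        then show ?thesis
          using e by (simp add: field_simps)
      qed
      from this[OF that(1)] this[OF that(2)] have "(norm (u m - u n))\<^sup>2 < e\<^sup>2"
        using dist_u[of m n] by linarith
      then show ?thesis
        using e by (simp add: power_less_imp_less_base)
    qed
    then show "\<exists>M. \<forall>m\<ge>M. \<forall>n\<ge>M. norm (u m - u n) < e"
      by blast
  qed
  then obtain z where z: "u \<longlonglongrightarrow> z"
    using Cauchy_convergent convergent_def by blast
  have "(\<lambda>n. J (u n)) \<longlonglongrightarrow> J z"
    unfolding J_def by (intro tendsto_intros f.tendsto z)
  moreover have "(\<lambda>n. d + 1 / real (Suc n)) \<longlonglongrightarrow> d + 0"
    by (intro tendsto_intros LIMSEQ_Suc[OF lim_1_over_n])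
  ultimately have Jz: "J z \<le> d"
    using LIMSEQ_le[of "\<lambda>n. J (u n)" "J z" "\<lambda>n. d + 1 / real (Suc n)" d] u
    by (metis add.right_neutral less_imp_le)
  have "f x = Re (cinner x z)" for x
  proof -
    define s where "s = Re (cinner x z) - f x"
    \<comment> \<open>Minimality of \<open>z\<close> along the line
      \<open>z + t *\<^sub>R x\<close>: a quadratic in \<open>t\<close> without constant term that
      is never negative has vanishing linear coefficient.\<close>
    have ineq: "0 \<le> t\<^sup>2 * (norm x)\<^sup>2 + 2 * t * s" for t
    proof -
      have "J (z + t *\<^sub>R x) = J z + t\<^sup>2 * (norm x)\<^sup>2 + 2 * t * s"
        using Re_cinner_commute[of z x]
        by (simp add: J_def s_def power2_norm_add f.add f.scaleR cinner_scaleR_right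
            power_mult_distrib algebra_simps)
      then show ?thesis
        using d_le[of "z + t *\<^sub>R x"] Jz by linarith
    qed
    \<comment> \<open>The added 1 keeps the divisor positive even for \<open>x = 0\<close>; at
      \<open>t = - s / q\<close> the quadratic is negative unless \<open>s = 0\<close>.\<close>
    define q where "q = (norm x)\<^sup>2 + 1"
    have q: "q > 0" "(norm x)\<^sup>2 = q - 1"
      by (auto simp: q_def add_nonneg_pos)
    have "0 \<le> (- s / q)\<^sup>2 * (q - 1) + 2 * (- s / q) * s"
      using ineq[of "- s / q"] q by simp
    also have "\<dots> = - (s\<^sup>2 * (q + 1) / q\<^sup>2)"
      using q(1) by (simp add: field_simps power2_eq_square)
    finally have "s\<^sup>2 * (q + 1) / q\<^sup>2 \<le> 0"
      by simp
    then have "s = 0"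
      using q(1) by (simp add: divide_le_0_iff mult_le_0_iff)
    then show ?thesis
      by (simp add: s_def)
  qed
  then show ?thesis
    by blast
qed

text \<open>Riesz representation, applied for each \<open>y\<close> to the real part of the
  functional, gives \<open>g y\<close>. Replacing \<open>x\<close> by \<open>c *\<^sub>C x\<close>
  then recovers the full complex identity.\<close>

lemma adjoint_exists:
  fixes T :: "'a::chilbert_space \<Rightarrow>\<^sub>L 'a"
  assumes T: "clinear_op T"
  shows "\<exists>S. \<forall>x y. cinner (blinfun_apply T x) y = cinner x (blinfun_apply S y)"
proof -
  have "\<exists>z. \<forall>x. Re (cinner (blinfun_apply T x) y) = Re (cinner x z)" for y
  proof (rule riesz_representation)
    show "bounded_linear (\<lambda>x. Re (cinner (blinfun_apply T x) y))"
      by (intro bounded_linear_compose[OF bounded_linear_Re]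
          bounded_linear_compose[OF bounded_bilinear.bounded_linear_left[OF bounded_bilinear_cinner]]
          blinfun.bounded_linear_right)
  qed
  then obtain g where g: "\<And>x y. Re (cinner (blinfun_apply T x) y) = Re (cinner x (g y))"
    by metis
  have "bounded_linear g"
  proof (rule bounded_linear_intro)
    show "g (x + y) = g x + g y" for x y
      by (rule cinner_ext) (simp add: g[symmetric] cinner_add_right)
    show "g (r *\<^sub>R x) = r *\<^sub>R g x" for r x
      by (rule cinner_ext) (simp add: g[symmetric] cinner_scaleR_right)
    \<comment> \<open>The identity \<open>g\<close> is used at \<open>x = g y\<close>; afterwards
      one factor \<open>norm (g y)\<close> is cancelled.\<close>
    show "norm (g y) \<le> norm y * norm T" for y
    proof (cases "g y = 0")
      case False
      have "norm (g y) * norm (g y) = Re (cinner (blinfun_apply T (g y)) y)"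
        by (simp add: g power2_norm_eq_Re_cinner[symmetric] power2_eq_square)
      also have "\<dots> \<le> norm (blinfun_apply T (g y)) * norm y"
        by (rule Re_cinner_le_norm)
      also have "\<dots> \<le> norm T * norm (g y) * norm y"
        by (intro mult_right_mono norm_blinfun) auto
      finally have "norm (g y) * norm (g y) \<le> norm (g y) * (norm y * norm T)"
        by (simp add: mult_ac)
      then show ?thesis
        using False by (simp add: mult_le_cancel_left)
    qed simp
  qed
  then have app: "blinfun_apply (Blinfun g) = g"
    by (rule bounded_linear_Blinfun_apply)
  have "cinner (blinfun_apply T x) y = cinner x (g y)" for x y
  proof (rule cinner_eqI_Re)
    show "Re (c * cinner (blinfun_apply T x) y) = Re (c * cinner x (g y))" for c
      using g[of "c *\<^sub>C x" y] T by (simp add: clinear_op_def cinner_scaleC_left)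
  qed
  then show ?thesis
    using app by metis
qed

text \<open>Uniqueness, which the definite description demands, comes from
  \<open>cinner_ext\<close>.\<close>

lemma adjoint_op_eqI:
  assumes "\<And>x y. cinner (blinfun_apply T x) y = cinner x (blinfun_apply S y)"
  shows "adjoint_op T = S"
  unfolding adjoint_op_def
proof (rule the_equality)
  show "\<forall>x y. cinner (blinfun_apply T x) y = cinner x (blinfun_apply S y)"
    using assms by blast
  show "S' = S"
    if "\<forall>x y. cinner (blinfun_apply T x) y = cinner x (blinfun_apply S' y)" for S'
    by (rule blinfun_eqI, rule cinner_ext) (simp add: assms[symmetric] that[rule_format, symmetric])
qed

context
  fixes T :: "'a::chilbert_space \<Rightarrow>\<^sub>L 'a"
  assumes T: "clinear_op T"
begin

lemma cinner_adjoint_right: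
  "cinner x (blinfun_apply (adjoint_op T) y) = cinner (blinfun_apply T x) y"
  using adjoint_exists[OF T] adjoint_op_eqI by metis

lemma cinner_adjoint_left:
  "cinner (blinfun_apply (adjoint_op T) x) y = cinner x (blinfun_apply T y)"
  by (metis cinner_adjoint_right cinner_commute)

lemma adjoint_adjoint: "adjoint_op (adjoint_op T) = T"
  by (rule adjoint_op_eqI) (rule cinner_adjoint_left)

lemma clinear_adjoint: "clinear_op (adjoint_op T)"
  unfolding clinear_op_def
  by (intro allI cinner_ext) (simp add: cinner_adjoint_right cinner_scaleC_right)

lemma norm_adjoint_apply_le: "norm (blinfun_apply (adjoint_op T) y) \<le> norm T * norm y"
proof (cases "blinfun_apply (adjoint_op T) y = 0")
  case False
  let ?v = "blinfun_apply (adjoint_op T) y"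
  have "norm ?v * norm ?v = Re (cinner (blinfun_apply T ?v) y)"
    by (simp add: cinner_adjoint_right[symmetric] power2_norm_eq_Re_cinner[symmetric]
        power2_eq_square)
  also have "\<dots> \<le> norm (blinfun_apply T ?v) * norm y"
    by (rule Re_cinner_le_norm)
  also have "\<dots> \<le> norm T * norm ?v * norm y"
    by (intro mult_right_mono norm_blinfun) auto
  finally have "norm ?v * norm ?v \<le> norm ?v * (norm T * norm y)"
    by (simp add: mult_ac)
  then show ?thesis
    using False by (simp add: mult_le_cancel_left)
qed simp

end

section \<open>Square roots of \<open>T\<^sup>*T\<close>\<close>

text \<open>The property carried through the iteration below and its limit; it makes the quadratic
  form of the limit real.\<close>

definition selfadjoint_op :: "('a::complex_inner \<Rightarrow>\<^sub>L 'a) \<Rightarrow> bool" where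
  "selfadjoint_op A \<longleftrightarrow>
    clinear_op A \<and> (\<forall>x y. cinner (blinfun_apply A x) y = cinner x (blinfun_apply A y))"

lemma selfadjoint_op_limit:
  assumes Y: "\<And>n. selfadjoint_op (Y n)" and lim: "Y \<longlonglongrightarrow> L"
  shows "selfadjoint_op L"
proof -
  have app: "(\<lambda>n. blinfun_apply (Y n) x) \<longlonglongrightarrow> blinfun_apply L x" for x
    by (intro blinfun.tendsto lim tendsto_const)
  have "blinfun_apply L (c *\<^sub>C x) = c *\<^sub>C blinfun_apply L x" for c x
  proof (rule LIMSEQ_unique[OF app])
    show "(\<lambda>n. blinfun_apply (Y n) (c *\<^sub>C x)) \<longlonglongrightarrow> c *\<^sub>C blinfun_apply L x"
      using bounded_linear.tendsto[OF bounded_linear_scaleC app] Y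
      by (simp add: selfadjoint_op_def clinear_op_def)
  qed
  moreover have "cinner (blinfun_apply L x) y = cinner x (blinfun_apply L y)" for x y
  proof (rule LIMSEQ_unique)
    show "(\<lambda>n. cinner (blinfun_apply (Y n) x) y) \<longlonglongrightarrow> cinner (blinfun_apply L x) y"
      by (intro bounded_bilinear.tendsto[OF bounded_bilinear_cinner] app tendsto_const)
    have "(\<lambda>n. cinner x (blinfun_apply (Y n) y)) \<longlonglongrightarrow> cinner x (blinfun_apply L y)"
      by (intro bounded_bilinear.tendsto[OF bounded_bilinear_cinner] app tendsto_const)
    then show "(\<lambda>n. cinner (blinfun_apply (Y n) x) y) \<longlonglongrightarrow> cinner x (blinfun_apply L y)"
      using Y by (simp add: selfadjoint_op_def)
  qed
  ultimately show ?thesis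
    by (simp add: selfadjoint_op_def clinear_op_def)
qed

text \<open>With \<open>Y = I - S\<close>, the equation \<open>S\<^sup>2 = I - B\<close> becomes the fixed point equation
  \<open>Y = (B + Y\<^sup>2) / 2\<close>.\<close>

primrec sqrt_iter :: "('a::real_normed_vector \<Rightarrow>\<^sub>L 'a) \<Rightarrow> nat \<Rightarrow> ('a \<Rightarrow>\<^sub>L 'a)" where
  "sqrt_iter B 0 = 0"
| "sqrt_iter B (Suc n) = (1/2) *\<^sub>R (B + (sqrt_iter B n o\<^sub>L sqrt_iter B n))"

text \<open>The same iteration for the scalar \<open>B = 1\<close>; it majorizes the operator iteration for all
  \<open>B\<close> with \<open>\<parallel>B\<parallel> \<le> 1\<close>.\<close>

primrec sqrt_maj :: "nat \<Rightarrow> real" where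
  "sqrt_maj 0 = 0"
| "sqrt_maj (Suc n) = (1 + (sqrt_maj n)\<^sup>2) / 2"

lemma sqrt_maj_bounds: "0 \<le> sqrt_maj n \<and> sqrt_maj n \<le> 1"
  by (induction n) (auto simp: power_le_one)

lemma sqrt_maj_Suc_ge: "sqrt_maj n \<le> sqrt_maj (Suc n)"
proof -
  have "0 \<le> (sqrt_maj n - 1)\<^sup>2"
    by simp
  then show ?thesis
    by (simp add: power2_eq_square algebra_simps)
qed

lemma convergent_sqrt_maj: "convergent sqrt_maj"
  by (intro Bseq_monoseq_convergent BseqI'[of _ 1])
    (use sqrt_maj_bounds sqrt_maj_Suc_ge in \<open>auto simp: monoseq_Suc\<close>)

context
  fixes B :: "'a::chilbert_space \<Rightarrow>\<^sub>L 'a"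
  assumes B: "norm B \<le> 1"
begin

lemma norm_sqrt_iter_le: "norm (sqrt_iter B n) \<le> sqrt_maj n"
proof (induction n)
  case (Suc n)
  have "norm (B + (sqrt_iter B n o\<^sub>L sqrt_iter B n)) \<le> 1 + (sqrt_maj n)\<^sup>2"
    unfolding power2_eq_square
    by (intro norm_triangle_mono B order_trans[OF norm_blinfun_compose] mult_mono Suc
        order_trans[OF norm_ge_zero Suc]) auto
  then show ?case
    by simp
qed simp

text \<open>The splitting \<open>Z\<^sup>2 - Y\<^sup>2 = Z (Z - Y) + (Z - Y) Y\<close> holds without
  commutativity, and bounding each factor by its scalar counterpart gives exactly the increment of
  the majorant.\<close>

lemma norm_sqrt_iter_diff_le:
  "norm (sqrt_iter B (Suc n) - sqrt_iter B n) \<le> sqrt_maj (Suc n) - sqrt_maj n"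
proof (induction n)
  case 0
  have "(0::'a \<Rightarrow>\<^sub>L 'a) o\<^sub>L 0 = 0"
    by (rule blinfun_eqI) simp
  then show ?case
    using B by simp
next
  case (Suc n)
  define Y where "Y = sqrt_iter B n"
  define Z where "Z = sqrt_iter B (Suc n)"
  define y where "y = sqrt_maj n"
  define z where "z = sqrt_maj (Suc n)"
  have D: "norm (Z - Y) \<le> z - y"
    using Suc by (simp only: Y_def Z_def y_def z_def)
  have Y: "norm Y \<le> y" and Z: "norm Z \<le> z"
    unfolding Y_def Z_def y_def z_def by (rule norm_sqrt_iter_le)+
  have yz: "0 \<le> y" "0 \<le> z" "y \<le> z"
    using sqrt_maj_bounds sqrt_maj_Suc_ge by (auto simp only: y_def z_def)
  have "sqrt_iter B (Suc (Suc n)) - sqrt_iter B (Suc n)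
      = (1/2) *\<^sub>R (B + (Z o\<^sub>L Z)) - (1/2) *\<^sub>R (B + (Y o\<^sub>L Y))"
    by (simp only: sqrt_iter.simps(2) Y_def Z_def)
  also have "\<dots> = (1/2) *\<^sub>R ((Z o\<^sub>L (Z - Y)) + ((Z - Y) o\<^sub>L Y))"
    by (rule blinfun_eqI)
      (simp add: blinfun.bilinear_simps blinfun_apply_blinfun_compose algebra_simps)
  finally have "norm (sqrt_iter B (Suc (Suc n)) - sqrt_iter B (Suc n))
      = (1/2) * norm ((Z o\<^sub>L (Z - Y)) + ((Z - Y) o\<^sub>L Y))"
    by simp
  also have "\<dots> \<le> (1/2) * (z * (z - y) + (z - y) * y)"
    using yz
    by (intro mult_left_mono norm_triangle_mono order_trans[OF norm_blinfun_compose] mult_mono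
        Y Z D) auto
  also have "\<dots> = sqrt_maj (Suc (Suc n)) - sqrt_maj (Suc n)"
    by (subst (1 2) sqrt_maj.simps(2))
      (simp add: y_def[symmetric] z_def power2_eq_square field_simps)
  finally show ?case .
qed

text \<open>The increments are dominated by a convergent telescoping series, hence summable in the
  complete operator space, and their partial sums are the iterates.\<close>

lemma convergent_sqrt_iter: "convergent (sqrt_iter B)"
proof -
  have "summable (\<lambda>n. sqrt_iter B (Suc n) - sqrt_iter B n)"
  proof (rule summable_comparison_test'[where N = 0])
    show "summable (\<lambda>n. sqrt_maj (Suc n) - sqrt_maj n)"
      using telescope_summable convergent_sqrt_maj convergent_def by blast
  qed (rule norm_sqrt_iter_diff_le)
  then have "convergent (\<lambda>n. \<Sum>i<n. sqrt_iter B (Suc i) - sqrt_iter B i)"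
    by (simp add: summable_iff_convergent)
  then show ?thesis
    by (simp only: sum_lessThan_telescope sqrt_iter.simps(1) diff_zero)
qed

lemma selfadjoint_sqrt_iter:
  assumes "selfadjoint_op B"
  shows "selfadjoint_op (sqrt_iter B n)"
proof (induction n)
  case 0
  have "c *\<^sub>C (0::'a) = 0" for c
    using norm_scaleC[of c "0::'a"] by simp
  moreover have "cinner (0::'a) y = 0" "cinner x (0::'a) = 0" for x y :: 'a
    using cinner_scaleR_left[of 0 0 y] cinner_scaleR_right[of x 0 0] by simp_all
  ultimately show ?case
    by (simp add: selfadjoint_op_def clinear_op_def)
next
  case (Suc n)
  then show ?case
    using assms
    by (simp add: selfadjoint_op_def clinear_op_def blinfun.bilinear_simps scaleC_add_right
        cinner_add_left cinner_add_right cinner_scaleC_left cinner_scaleC_right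
        scaleR_scaleC scaleC_scaleC mult.commute)
qed

text \<open>The root is \<open>id_blinfun - Y\<close> for the limit \<open>Y\<close> of the
  iteration. It is positive because \<open>Y\<close> is self-adjoint with norm at most 1.\<close>

lemma sqrt_one_minus_exists:
  assumes sa: "selfadjoint_op B"
  shows "\<exists>S. positive_op S \<and> S o\<^sub>L S = id_blinfun - B"
proof -
  obtain Y where Y: "sqrt_iter B \<longlonglongrightarrow> Y"
    using convergent_sqrt_iter convergent_def by blast
  have saY: "selfadjoint_op Y"
    using selfadjoint_op_limit[OF selfadjoint_sqrt_iter[OF sa] Y] .
  have normY: "norm Y \<le> 1"
    by (rule tendsto_le[OF _ tendsto_const tendsto_norm[OF Y]])
      (auto intro!: always_eventually order_trans[OF norm_sqrt_iter_le] simp: sqrt_maj_bounds)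
  have "(\<lambda>n. sqrt_iter B (Suc n)) \<longlonglongrightarrow> (1/2) *\<^sub>R (B + (Y o\<^sub>L Y))"
    unfolding sqrt_iter.simps
    by (intro tendsto_intros bounded_bilinear.tendsto[OF bounded_bilinear_blinfun_compose] Y)
  then have "Y = (1/2) *\<^sub>R (B + (Y o\<^sub>L Y))"
    using LIMSEQ_unique[OF LIMSEQ_Suc[OF Y]] by blast
  then have fp:
    "blinfun_apply Y x = (1/2) *\<^sub>R (blinfun_apply B x + blinfun_apply Y (blinfun_apply Y x))"
    for x
    by (metis blinfun.add_left blinfun.scaleR_left blinfun_apply_blinfun_compose)
  have "(id_blinfun - Y) o\<^sub>L (id_blinfun - Y) = id_blinfun - B"
  proof (rule blinfun_eqI)
    fix x
    \<comment> \<open>The fixed point equation, doubled, replaces the cross terms of the expanded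
      square.\<close>
    have "blinfun_apply Y x + blinfun_apply Y x
        = blinfun_apply B x + blinfun_apply Y (blinfun_apply Y x)"
      by (subst (1 2) fp) (simp add: scaleR_left_distrib[symmetric])
    then show "blinfun_apply ((id_blinfun - Y) o\<^sub>L (id_blinfun - Y)) x
        = blinfun_apply (id_blinfun - B) x"
      by (simp add: blinfun.bilinear_simps algebra_simps)
  qed
  moreover have "positive_op (id_blinfun - Y)"
    unfolding positive_op_def
  proof (intro conjI allI)
    show "clinear_op (id_blinfun - Y)"
      using saY
      by (simp add: clinear_op_def selfadjoint_op_def blinfun.bilinear_simps
          scaleC_diff_right)
    fix x
    have "Im (cinner (blinfun_apply Y x) x) = 0"
      using saY arg_cong[OF cinner_commute[of "blinfun_apply Y x" x], of Im]
      by (simp add: selfadjoint_op_def)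
    moreover have "Re (cinner (blinfun_apply Y x) x) \<le> (norm x)\<^sup>2"
    proof -
      have "Re (cinner (blinfun_apply Y x) x) \<le> norm (blinfun_apply Y x) * norm x"
        by (rule Re_cinner_le_norm)
      also have "\<dots> \<le> (1 * norm x) * norm x"
        by (intro mult_right_mono order_trans[OF norm_blinfun] normY) auto
      finally show ?thesis
        by (simp add: power2_eq_square)
    qed
    ultimately show "cinner (blinfun_apply (id_blinfun - Y) x) x \<in> \<real>\<^sub>\<ge>\<^sub>0"
      by (simp add: complex_nonneg_Reals_iff blinfun.bilinear_simps cinner_diff_left cinner_self)
  qed
  ultimately show ?thesis
    by blast
qed

end

text \<open>Scaling by a small \<open>s\<close> makes \<open>B\<close>, the identity minus
  \<open>s\<close> times \<open>T\<^sup>*T\<close>, a contraction. The root of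
  \<open>id_blinfun - B\<close> is then scaled back.\<close>

lemma sqrt_adjoint_compose_exists:
  fixes T :: "'a::chilbert_space \<Rightarrow>\<^sub>L 'a"
  assumes T: "clinear_op T"
  shows "\<exists>S. positive_op S \<and> S o\<^sub>L S = adjoint_op T o\<^sub>L T"
proof -
  note adj = cinner_adjoint_left[OF T] cinner_adjoint_right[OF T]
  \<comment> \<open>The summand 1 keeps \<open>k\<close> positive when \<open>T = 0\<close>.\<close>
  define k where "k = 1 + norm T"
  define s where "s = 1 / k\<^sup>2"
  define B where "B = id_blinfun - s *\<^sub>R (adjoint_op T o\<^sub>L T)"
  have k: "k > 0"
    by (simp add: k_def add_pos_nonneg)
  have s: "s > 0" "s * (norm T)\<^sup>2 \<le> 1"
    using k by (auto simp: s_def k_def divide_simps intro!: power_mono)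
  have B_apply: "blinfun_apply B x = x - s *\<^sub>R blinfun_apply (adjoint_op T) (blinfun_apply T x)" for x
    by (simp add: B_def blinfun.bilinear_simps)
  have "norm B \<le> 1"
  proof (rule norm_blinfun_bound)
    fix x
    let ?v = "blinfun_apply T x"
    let ?u = "blinfun_apply (adjoint_op T) ?v"
    \<comment> \<open>In the expansion of the squared norm of \<open>B x\<close>, this quadratic
      term is absorbed by half of the negative term
      \<open>- 2 * s * (norm ?v)\<^sup>2\<close>.\<close>
    have "s\<^sup>2 * (norm ?u)\<^sup>2 \<le> s\<^sup>2 * (norm T * norm ?v)\<^sup>2"
      by (intro mult_left_mono power_mono norm_adjoint_apply_le[OF T]) auto
    also have "\<dots> = (s * (norm T)\<^sup>2) * (s * (norm ?v)\<^sup>2)"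
      by (simp add: power2_eq_square mult_ac)
    also have "\<dots> \<le> 1 * (s * (norm ?v)\<^sup>2)"
      using s by (intro mult_right_mono) auto
    finally have u: "s\<^sup>2 * (norm ?u)\<^sup>2 \<le> s * (norm ?v)\<^sup>2"
      by simp
    have "(norm (blinfun_apply B x))\<^sup>2 = (norm x)\<^sup>2 + s\<^sup>2 * (norm ?u)\<^sup>2 - 2 * s * (norm ?v)\<^sup>2"
      using s(1)
      by (simp add: B_apply power2_norm_diff cinner_scaleR_right adj cinner_self power_mult_distrib)
    also have "\<dots> \<le> (norm x)\<^sup>2"
    proof -
      have "0 \<le> s * (norm ?v)\<^sup>2"
        using s(1) by simp
      then show ?thesis
        using u by linarith
    qed
    finally have "norm (blinfun_apply B x) \<le> norm x"
      by (rule power2_le_imp_le) simp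
    then show "norm (blinfun_apply B x) \<le> 1 * norm x"
      by simp
  qed simp
  moreover have "selfadjoint_op B"
    using T clinear_adjoint[OF T]
    by (simp add: selfadjoint_op_def clinear_op_def B_apply cinner_diff_left cinner_diff_right
        cinner_scaleC_left cinner_scaleC_right adj scaleR_scaleC scaleC_scaleC mult.commute
        scaleC_diff_right)
  ultimately obtain S where S: "positive_op S" "S o\<^sub>L S = id_blinfun - B"
    using sqrt_one_minus_exists by blast
  have "(k *\<^sub>R S) o\<^sub>L (k *\<^sub>R S) = k\<^sup>2 *\<^sub>R (S o\<^sub>L S)"
    by (rule blinfun_eqI) (simp add: blinfun.bilinear_simps power2_eq_square)
  also have "\<dots> = adjoint_op T o\<^sub>L T"
    using k by (simp add: S B_def s_def)
  finally have "(k *\<^sub>R S) o\<^sub>L (k *\<^sub>R S) = adjoint_op T o\<^sub>L T" .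
  moreover have "positive_op (k *\<^sub>R S)"
    using S(1) k
    by (auto simp: positive_op_def clinear_op_def blinfun.bilinear_simps cinner_scaleC_left
        scaleR_scaleC scaleC_scaleC mult.commute complex_nonneg_Reals_iff)
  ultimately show ?thesis
    by blast
qed

text \<open>Existence of a root makes the choice in \<open>sqrt_op\<close> meet its specification.
  The theorem involves \<open>abs_op\<close> only through even powers, so this removes it
  entirely.\<close>

lemma abs_op_compose_abs_op:
  assumes "clinear_op T"
  shows "abs_op T o\<^sub>L abs_op T = adjoint_op T o\<^sub>L T"
  using someI_ex[OF sqrt_adjoint_compose_exists[OF assms]] by (simp add: abs_op_def sqrt_op_def)

lemma op_power_2: "op_power A 2 = A o\<^sub>L A"
  by (rule blinfun_eqI) (simp add: numeral_2_eq_2)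

text \<open>Bracketed as a square of squares so that \<open>abs_op_compose_abs_op\<close> rewrites
  both factors.\<close>

lemma op_power_4: "op_power A 4 = (A o\<^sub>L A) o\<^sub>L (A o\<^sub>L A)"
  by (rule blinfun_eqI) (simp add: eval_nat_numeral)

section \<open>The numerical radius\<close>

lemma bdd_above_numerical_range:
  "bdd_above (insert 0 {cmod (cinner (blinfun_apply T x) x) | x. norm x = 1})"
proof (rule bdd_aboveI)
  fix m
  assume "m \<in> insert 0 {cmod (cinner (blinfun_apply T x) x) | x. norm x = 1}"
  then consider "m = 0" | x where "norm x = 1" "m = cmod (cinner (blinfun_apply T x) x)"
    by blast
  then show "m \<le> norm T"
  proof cases
    case (2 x)
    then show ?thesis
      using norm_cinner_le[of "blinfun_apply T x" x] norm_blinfun[of T x] by simp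
  qed simp
qed

lemma numerical_radius_upper:
  "norm x = 1 \<Longrightarrow> cmod (cinner (blinfun_apply T x) x) \<le> numerical_radius T"
  unfolding numerical_radius_def by (rule cSup_upper[OF _ bdd_above_numerical_range]) blast

text \<open>The inserted 0 is itself a member of the set.\<close>

lemma numerical_radius_nonneg: "0 \<le> numerical_radius T"
  unfolding numerical_radius_def by (rule cSup_upper[OF _ bdd_above_numerical_range]) blast

lemma numerical_radius_le:
  assumes "0 \<le> K" "\<And>x. norm x = 1 \<Longrightarrow> cmod (cinner (blinfun_apply T x) x) \<le> K"
  shows "numerical_radius T \<le> K"
  unfolding numerical_radius_def by (rule cSup_least) (use assms in auto)

lemma Re_cinner_blinfun_le: "Re (cinner (blinfun_apply A x) x) \<le> norm A * (norm x)\<^sup>2"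
proof -
  have "Re (cinner (blinfun_apply A x) x) \<le> norm (blinfun_apply A x) * norm x"
    by (rule Re_cinner_le_norm)
  also have "\<dots> \<le> (norm A * norm x) * norm x"
    by (intro mult_right_mono norm_blinfun) auto
  finally show ?thesis
    by (simp add: power2_eq_square)
qed

section \<open>Norm and numerical radius estimates for
  \<open>T\<^sup>*T + TT\<^sup>*\<close>\<close>

context
  fixes T :: "'a::chilbert_space \<Rightarrow>\<^sub>L 'a"
  assumes T: "clinear_op T"
begin

text \<open>By \<open>abs_op_compose_abs_op\<close>, these two are the squares of
  \<open>abs_op T\<close> and \<open>abs_op (adjoint_op T)\<close>.\<close>

abbreviation "gram \<equiv> adjoint_op T o\<^sub>L T"
abbreviation "cogram \<equiv> T o\<^sub>L adjoint_op T"

text \<open>The left side is the quadratic form of \<open>gram + cogram\<close> at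
  \<open>x\<close>.\<close>

lemma norms_le_norm_sum:
  "(norm (blinfun_apply T x))\<^sup>2 + (norm (blinfun_apply (adjoint_op T) x))\<^sup>2
    \<le> norm (gram + cogram) * (norm x)\<^sup>2"
  using Re_cinner_blinfun_le[of "gram + cogram" x]
  by (simp add: blinfun.bilinear_simps cinner_add_left cinner_adjoint_left[OF T]
      cinner_adjoint_right[OF T, symmetric] cinner_self)

text \<open>The parallelogram law bounds the squared norm of a sum by twice the sum of squared
  norms; by symmetry of \<open>gram\<close> and \<open>cogram\<close>, the latter sum is the
  quadratic form of \<open>gram\<^sup>2 + cogram\<^sup>2\<close>.\<close>

lemma power2_norm_sum_le:
  "(norm (gram + cogram))\<^sup>2 \<le> 2 * norm ((gram o\<^sub>L gram) + (cogram o\<^sub>L cogram))"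
proof -
  let ?N = "norm ((gram o\<^sub>L gram) + (cogram o\<^sub>L cogram))"
  have "norm (gram + cogram) \<le> sqrt (2 * ?N)"
  proof (rule norm_blinfun_bound)
    fix x
    let ?p = "blinfun_apply gram x"
    let ?q = "blinfun_apply cogram x"
    have "(norm (?p + ?q))\<^sup>2 + (norm (?p - ?q))\<^sup>2 = 2 * ((norm ?p)\<^sup>2 + (norm ?q)\<^sup>2)"
      by (simp only: power2_norm_add power2_norm_diff) simp
    then have "(norm (?p + ?q))\<^sup>2 \<le> 2 * ((norm ?p)\<^sup>2 + (norm ?q)\<^sup>2)"
      using zero_le_power2[of "norm (?p - ?q)"] by linarith
    also have "(norm ?p)\<^sup>2 + (norm ?q)\<^sup>2
        = Re (cinner (blinfun_apply ((gram o\<^sub>L gram) + (cogram o\<^sub>L cogram)) x) x)"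
      by (simp add: blinfun.bilinear_simps cinner_add_left cinner_adjoint_left[OF T]
          cinner_adjoint_right[OF T, symmetric] power2_norm_eq_Re_cinner)
    also have "\<dots> \<le> ?N * (norm x)\<^sup>2"
      by (rule Re_cinner_blinfun_le)
    finally have "(norm (blinfun_apply (gram + cogram) x))\<^sup>2 \<le> (sqrt (2 * ?N) * norm x)\<^sup>2"
      by (simp add: blinfun.add_left power_mult_distrib mult.assoc)
    then show "norm (blinfun_apply (gram + cogram) x) \<le> sqrt (2 * ?N) * norm x"
      by (rule power2_le_imp_le) simp
  qed simp
  then have "(norm (gram + cogram))\<^sup>2 \<le> (sqrt (2 * ?N))\<^sup>2"
    by (intro power_mono) auto
  then show ?thesis
    by simp
qed

text \<open>Moving one \<open>T\<close> across the inner product leaves that of \<open>T x\<close>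
  with \<open>T\<^sup>* x\<close>; Cauchy-Schwarz and the arithmetic-geometric mean inequality
  finish.\<close>

lemma numerical_radius_square_le: "numerical_radius (T o\<^sub>L T) \<le> norm (gram + cogram) / 2"
proof (rule numerical_radius_le)
  fix x :: 'a
  assume x: "norm x = 1"
  let ?u = "blinfun_apply T x"
  let ?v = "blinfun_apply (adjoint_op T) x"
  have "cmod (cinner (blinfun_apply (T o\<^sub>L T) x) x) = cmod (cinner ?u ?v)"
    by (simp add: cinner_adjoint_right[OF T])
  also have "\<dots> \<le> norm ?u * norm ?v"
    by (rule norm_cinner_le)
  also have "\<dots> \<le> ((norm ?u)\<^sup>2 + (norm ?v)\<^sup>2) / 2"
    using sum_squares_bound[of "norm ?u" "norm ?v"] by simp
  also have "\<dots> \<le> norm (gram + cogram) / 2"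
    using norms_le_norm_sum[of x] x by simp
  finally show "cmod (cinner (blinfun_apply (T o\<^sub>L T) x) x) \<le> norm (gram + cogram) / 2" .
qed simp

lemma power2_numerical_radius_le:
  "(numerical_radius T)\<^sup>2 \<le> norm (gram + cogram) / 4 + numerical_radius (T o\<^sub>L T) / 2"
proof -
  let ?K = "norm (gram + cogram) / 4 + numerical_radius (T o\<^sub>L T) / 2"
  have K: "0 \<le> ?K"
    using numerical_radius_nonneg[of "T o\<^sub>L T"] by simp
  have "numerical_radius T \<le> sqrt ?K"
  proof (rule numerical_radius_le)
    fix x :: 'a
    assume x: "norm x = 1"
    let ?m = "cmod (cinner (blinfun_apply T x) x)"
    obtain c where c: "cmod c = 1" "c * cinner (blinfun_apply T x) x = complex_of_real ?m"
      using unit_phase by blast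
    \<comment> \<open>\<open>u + v\<close> is twice the real part of \<open>c T\<close> applied to
      \<open>x\<close>.\<close>
    define u where "u = c *\<^sub>C blinfun_apply T x"
    define v where "v = cnj c *\<^sub>C blinfun_apply (adjoint_op T) x"
    have ux: "cinner u x = complex_of_real ?m"
      using c by (simp add: u_def cinner_scaleC_left)
    have "cinner v x = cnj (cinner u x)"
      unfolding u_def v_def cinner_scaleC_left cinner_adjoint_left[OF T]
      by (simp add: cinner_commute[of x])
    then have "2 * ?m = Re (cinner (u + v) x)"
      by (simp add: ux cinner_add_left)
    also have "\<dots> \<le> norm (u + v)"
      using Re_cinner_le_norm[of "u + v" x] x by simp
    finally have "(2 * ?m)\<^sup>2 \<le> (norm (u + v))\<^sup>2"
      by (intro power_mono) auto
    also have "\<dots> = (norm u)\<^sup>2 + (norm v)\<^sup>2 + 2 * Re (cinner u v)"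
      by (rule power2_norm_add)
    also have "\<dots> \<le> norm (gram + cogram) + 2 * numerical_radius (T o\<^sub>L T)"
    proof -
      have "(norm u)\<^sup>2 + (norm v)\<^sup>2 \<le> norm (gram + cogram)"
        using norms_le_norm_sum[of x] x c by (simp add: u_def v_def norm_scaleC)
      moreover have "Re (cinner u v) \<le> numerical_radius (T o\<^sub>L T)"
      proof -
        \<comment> \<open>The conjugate on \<open>cnj c\<close> is undone in the second argument, so
          both phases multiply to \<open>c * c\<close>, of modulus 1.\<close>
        have "cinner u v = c * c * cinner (blinfun_apply (T o\<^sub>L T) x) x"
          using T by (simp add: u_def v_def cinner_scaleC_left cinner_scaleC_right
              cinner_adjoint_right[OF T] clinear_op_def)
        then have "cmod (cinner u v) = cmod (cinner (blinfun_apply (T o\<^sub>L T) x) x)"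
          using c by (simp add: norm_mult)
        then show ?thesis
          using numerical_radius_upper[OF x, of "T o\<^sub>L T"] complex_Re_le_cmod[of "cinner u v"]
          by linarith
      qed
      ultimately show ?thesis
        by linarith
    qed
    finally have "?m\<^sup>2 \<le> ?K"
      by (simp add: power_mult_distrib)
    then show "?m \<le> sqrt ?K"
      by (rule real_le_rsqrt)
  qed (use K in simp)
  then have "(numerical_radius T)\<^sup>2 \<le> (sqrt ?K)\<^sup>2"
    by (intro power_mono numerical_radius_nonneg)
  then show ?thesis
    using K by simp
qed

end

theorem theorem2p9:
  fixes T :: "'a::chilbert_space \<Rightarrow>\<^sub>L 'a" and lam :: real
  assumes "clinear_op T" and "lam \<ge> 0"
  shows "numerical_radius T ^ 4 \<le>
      (2 * lam + 3) / (8 * (lam + 1)) *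
        norm (op_power (abs_op T) 2 + op_power (abs_op (adjoint_op T)) 2) *
        numerical_radius (op_power T 2)
    + (2 * lam + 1) / (8 * (lam + 1)) *
        norm (op_power (abs_op T) 4 + op_power (abs_op (adjoint_op T)) 4)"
proof -
  let ?P = "adjoint_op T o\<^sub>L T" and ?Q = "T o\<^sub>L adjoint_op T"
  define w where "w = numerical_radius T"
  define v where "v = numerical_radius (T o\<^sub>L T)"
  define m where "m = norm (?P + ?Q)"
  define n where "n = norm ((?P o\<^sub>L ?P) + (?Q o\<^sub>L ?Q))"
  have m: "m\<^sup>2 \<le> 2 * n" "0 \<le> m"
    using power2_norm_sum_le[OF assms(1)] by (simp_all add: m_def n_def)
  have v: "v \<le> m / 2" "0 \<le> v"
    using numerical_radius_square_le[OF assms(1)] numerical_radius_nonneg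
    by (simp_all add: m_def v_def)
  have "w\<^sup>2 \<le> m / 4 + v / 2"
    using power2_numerical_radius_le[OF assms(1)] by (simp add: m_def v_def w_def)
  then have "(w\<^sup>2)\<^sup>2 \<le> (m / 4 + v / 2)\<^sup>2"
    by (rule power_mono) simp
  also have "\<dots> = m\<^sup>2 / 16 + m * v / 4 + v * v / 4"
    by (simp add: power2_eq_square field_simps)
  \<comment> \<open>\<open>m\<^sup>2 \<le> 2 * n\<close> handles the first term; in the last, only
    one factor \<open>v\<close> is replaced by \<open>m / 2\<close>. The result is the case
    \<open>lam = 0\<close>.\<close>
  also have "\<dots> \<le> n / 8 + m * v / 4 + (m / 2) * v / 4"
    using m v by (intro add_mono divide_right_mono mult_right_mono) auto
  finally have w: "w ^ 4 \<le> 3 / 8 * (m * v) + n / 8"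
    by simp
  \<comment> \<open>\<open>t / 2\<close> is the weight that \<open>lam\<close> shifts from the first
    coefficient to the second.\<close>
  define t where "t = lam / (4 * (lam + 1))"
  have t: "0 \<le> t" "(2 * lam + 3) / (8 * (lam + 1)) = 3 / 8 - t / 2"
    "(2 * lam + 1) / (8 * (lam + 1)) = 1 / 8 + t / 2"
    using assms(2) by (simp_all add: t_def field_simps)
  \<comment> \<open>Since \<open>m * v \<le> m\<^sup>2 / 2 \<le> n\<close>, shifting weight from
    \<open>m * v\<close> to \<open>n\<close> can only increase the bound.\<close>
  have "m * v \<le> m * (m / 2)"
    using m v by (intro mult_left_mono) auto
  then have "m * v \<le> n"
    using m(1) by (simp add: power2_eq_square)
  then have "t / 2 * (m * v) \<le> t / 2 * n"
    using t(1) by (intro mult_left_mono) auto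
  with w have "w ^ 4 \<le> (3 / 8 - t / 2) * m * v + (1 / 8 + t / 2) * n"
    by (simp add: algebra_simps)
  then show ?thesis
    unfolding op_power_2 op_power_4 abs_op_compose_abs_op[OF assms(1)]
      abs_op_compose_abs_op[OF clinear_adjoint[OF assms(1)]] adjoint_adjoint[OF assms(1)] t
      w_def v_def m_def n_def .
qed

end
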